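(* Let $n\ge2$, $A\ge1$ and $B>0$. There exists a constant $p_0=p_0(n,A,B)>0$, depending only on $n,A,B$, such that $$\int_{\mathbb{S}^{n-1}}\left(\int_0^1\rho(t\omega)\,dt\right)^p d\sigma(\omega)<\infty$$ whenever $0<p<p_0$ and $\rho$ is a conformal density on $\mathbb{B}^n$ satisfying HI$(A)$ and VG$(B)$.
   Context: Notation: $\mathbb{B}^n=\{x\in\mathbb{R}^n:|x|<1\}$, $\mathbb{S}^{n-1}=\{x\in\mathbb{R}^n:|x|=1\}$, $\sigma$ is the $(n-1)$-dimensional surface measure on $\mathbb{S}^{n-1}$, and $B_x=B(x,(1-|x|)/2)$ (Euclidean ball) for $x\in\mathbb{B}^n$. For a continuous function $\rho:\mathbb{B}^n\to(0,\infty)$, put $\mathrm{length}_\rho(\gamma)=\int_\gamma\rho\,ds$ (arc length integration) for a curve $\gamma$. For $x,y\in\mathbb{B}^n$ let $d_\rho(x,y)=\inf\mathrm{length}_\rho(\gamma)$, the infimum over all curves $\gamma\subset\mathbb{B}^n$ with endpoints $x$ and $y$, and let $B_\rho(x,r)=\{y\in\mathbb{B}^n:d_\rho(x,y)<r\}$. $\rho$ satisfies HI$(A)$, $A\ge1$, if for every $z\in\mathbb{B}^n$: $1/A\le\rho(x)/\rho(y)\le A$ for all $x,y\in B_z$. $\rho$ satisfies VG$(B)$, $B>0$, if $\int_{B_\rho(x,r)}\rho^n\,dx\le Br^n$ for all $x\in\mathbb{B}^n$, $r>0$. A conformal density on $\mathbb{B}^n$ is a continuous $\rho:\mathbb{B}^n\to(0,\infty)$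 satisfying HI$(A)$ and VG$(B)$ for some $A\ge1$, $B>0$. *)

theory Defs
  imports "HOL-Analysis.Analysis"
begin

section \<open>Arc length and integration with respect to arc length\<close>

text \<open>
  The length of the restriction of \<open>g\<close> to \<open>[a, b]\<close>: the supremum over all subdivisions
  \<open>a \<le> t 0 \<le> \<dots> \<le> t k \<le> b\<close>, infinite if \<open>g\<close> is not rectifiable.
\<close>

definition arc_length :: "(real \<Rightarrow> 'a::metric_space) \<Rightarrow> real \<Rightarrow> real \<Rightarrow> ennreal" where
  "arc_length g a b =
     (SUP (k, t) \<in> {(k::nat, t::nat \<Rightarrow> real). mono_on {..k} t \<and> t ` {..k} \<subseteq> {a..b}}.
        \<Sum>i<k. ennreal (dist (g (t i)) (g (t (Suc i)))))"

text \<open>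
  The arc length parametrization of a rectifiable path \<open>g\<close>.  For \<open>0 \<le> s \<le> arc_length g 0 1\<close> it
  takes the value of \<open>g\<close> at a parameter \<open>t\<close> such that \<open>g\<close> has length \<open>s\<close> on \<open>[0, t]\<close>; the
  choice of \<open>t\<close> is irrelevant because \<open>g\<close> is constant between any two such parameters.
\<close>

definition arc_length_param :: "(real \<Rightarrow> 'a::metric_space) \<Rightarrow> real \<Rightarrow> 'a" where
  "arc_length_param g s = g (inv_into {0..1} (\<lambda>t. enn2real (arc_length g 0 t)) s)"

text \<open>Non-rectifiable paths get infinite weighted length.\<close>

definition weighted_length :: "('a::metric_space \<Rightarrow> real) \<Rightarrow> (real \<Rightarrow> 'a) \<Rightarrow> ennreal" where
  "weighted_length \<rho> g =
     (if arc_length g 0 1 = \<infinity> then \<infinity>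
      else \<integral>\<^sup>+s\<in>{0..enn2real (arc_length g 0 1)}. ennreal (\<rho> (arc_length_param g s)) \<partial>lborel)"


section \<open>Conformal densities on the unit ball\<close>

definition density_dist :: "(real^'n \<Rightarrow> real) \<Rightarrow> real^'n \<Rightarrow> real^'n \<Rightarrow> ennreal" where
  "density_dist \<rho> x y =
     (INF g \<in> {g. path g \<and> path_image g \<subseteq> ball 0 1 \<and> pathstart g = x \<and> pathfinish g = y}.
        weighted_length \<rho> g)"

definition density_ball :: "(real^'n \<Rightarrow> real) \<Rightarrow> real^'n \<Rightarrow> real \<Rightarrow> (real^'n) set" where
  "density_ball \<rho> x r = {y \<in> ball 0 1. density_dist \<rho> x y < ennreal r}"

definition whitney_ball :: "real^'n \<Rightarrow> (real^'n) set" where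
  "whitney_ball x = ball x ((1 - norm x) / 2)"

definition harnack_ineq :: "real \<Rightarrow> (real^'n \<Rightarrow> real) \<Rightarrow> bool" where
  "harnack_ineq A \<rho> \<longleftrightarrow>
     (\<forall>z \<in> ball 0 1. \<forall>x \<in> whitney_ball z. \<forall>y \<in> whitney_ball z.
        1 / A \<le> \<rho> x / \<rho> y \<and> \<rho> x / \<rho> y \<le> A)"

definition volume_growth :: "real \<Rightarrow> (real^'n \<Rightarrow> real) \<Rightarrow> bool" where
  "volume_growth B \<rho> \<longleftrightarrow>
     (\<forall>x \<in> ball 0 1. \<forall>r > 0.
        (\<integral>\<^sup>+y\<in>density_ball \<rho> x r. ennreal (\<rho> y ^ CARD('n)) \<partial>lborel) \<le> ennreal (B * r ^ CARD('n)))"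

text \<open>
  \<open>\<rho>\<close> is a total function; its values outside the open unit ball are irrelevant for the notions
  of this section.
\<close>

definition conformal_density :: "(real^'n \<Rightarrow> real) \<Rightarrow> bool" where
  "conformal_density \<rho> \<longleftrightarrow>
     continuous_on (ball 0 1) \<rho> \<and> (\<forall>x \<in> ball 0 1. 0 < \<rho> x) \<and>
     (\<exists>A\<ge>1. harnack_ineq A \<rho>) \<and> (\<exists>B>0. volume_growth B \<rho>)"


section \<open>Surface measure on the unit sphere and real powers\<close>

text \<open>
  The surface measure of polar coordinates: \<open>\<sigma>(E)\<close> is \<open>n\<close> times the Lebesgue measure of the cone
  \<open>{r \<omega> | 0 < r < 1, \<omega> \<in> E}\<close> (see \<open>emeasure_sphere_measure\<close>), that is, \<open>n\<close> times the image of
  Lebesgue measure on the punctured unit ball under radial projection.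
\<close>

definition sphere_measure :: "(real^'n) measure" where
  "sphere_measure =
     scale_measure (of_nat CARD('n))
       (distr (restrict_space lborel (ball 0 1 - {0})) (restrict_space borel (sphere 0 1))
          (\<lambda>x. x /\<^sub>R norm x))"

lemma space_sphere_measure [simp]: "space sphere_measure = sphere 0 1"
  by (simp add: sphere_measure_def space_scale_measure space_restrict_space)

lemma sets_sphere_measure: "sets sphere_measure = sets (restrict_space borel (sphere 0 1))"
  by (simp add: sphere_measure_def)

lemma emeasure_sphere_measure:
  fixes E :: "(real^'n) set"
  assumes "E \<in> sets borel" "E \<subseteq> sphere 0 1"
  shows "emeasure sphere_measure E =
           of_nat CARD('n) * emeasure lborel {r *\<^sub>R \<omega> |r \<omega>. 0 < r \<and> r < 1 \<and> \<omega> \<in> E}"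
proof -
  have meas: "(\<lambda>x::real^'n. x /\<^sub>R norm x) \<in>
      restrict_space lborel (ball 0 1 - {0}) \<rightarrow>\<^sub>M restrict_space borel (sphere 0 1)"
    by (intro measurable_restrict_space2 measurable_restrict_space1)
       (auto simp: space_restrict_space)
  have E: "E \<in> sets (restrict_space borel (sphere 0 1))"
    using assms by (auto simp: sets_restrict_space)
  have cone: "(\<lambda>x. x /\<^sub>R norm x) -` E \<inter> (ball 0 1 - {0})
      = {r *\<^sub>R \<omega> |r \<omega>. 0 < r \<and> r < 1 \<and> \<omega> \<in> E}" (is "?L = ?R")
  proof (intro equalityI subsetI)
    fix x assume x: "x \<in> ?L"
    then have "x = norm x *\<^sub>R (x /\<^sub>R norm x)" "0 < norm x" "norm x < 1" "x /\<^sub>R norm x \<in> E"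
      by auto
    then show "x \<in> ?R" by blast
  next
    fix x assume "x \<in> ?R"
    then obtain r \<omega> where r: "x = r *\<^sub>R \<omega>" "0 < r" "r < 1" "\<omega> \<in> E" by blast
    with assms(2) have "norm \<omega> = 1" by auto
    with r show "x \<in> ?L" by auto
  qed
  have sub: "{r *\<^sub>R \<omega> |r \<omega>. 0 < r \<and> r < 1 \<and> \<omega> \<in> E} \<subseteq> ball 0 1 - {0}"
    unfolding cone[symmetric] by blast
  have "emeasure (restrict_space lborel (ball 0 1 - {0})) {r *\<^sub>R \<omega> |r \<omega>. 0 < r \<and> r < 1 \<and> \<omega> \<in> E}
      = emeasure lborel {r *\<^sub>R \<omega> |r \<omega>. 0 < r \<and> r < 1 \<and> \<omega> \<in> E}"
    by (rule emeasure_restrict_space) (use sub in auto)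
  then show ?thesis
    unfolding sphere_measure_def
    using E by (simp add: emeasure_scale_measure emeasure_distr[OF meas E] space_restrict_space cone)
qed

text \<open>The \<open>p\<close>-th power, for \<open>p > 0\<close>, of a quantity in \<open>[0, \<infinity>]\<close>.\<close>

definition ennreal_rpow :: "ennreal \<Rightarrow> real \<Rightarrow> ennreal" where
  "ennreal_rpow x p = (if x = \<infinity> then \<infinity> else ennreal (enn2real x powr p))"

end

theory Submission
  imports Defs
begin

text \<open>
  Write \<open>R(x)\<close> for the \<open>\<rho>\<close>-length of the segment from \<open>0\<close> to \<open>x\<close>.  Along a ray,
  \<open>(1 + R)\<^sup>p\<close> has derivative \<open>p (1 + R)\<^bsup>p-1\<^esup> \<rho>\<close>, which Young's inequality splits into
  \<open>\<rho>\<^sup>n (1 + R)\<^bsup>-n(1+p)\<^esup> + (1 + R)\<^bsup>4p\<^esup>\<close>.  The first term is integrable over the ball because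
  \<open>{R < r}\<close> lies in the \<open>\<rho>\<close>-ball of radius \<open>r\<close> about \<open>0\<close>, whose \<open>\<rho>\<^sup>n\<close>-volume is at most \<open>B r\<^sup>n\<close>.
  The second is integrable along every ray for small \<open>p\<close>, since iterating the Harnack inequality
  gives \<open>R(x) \<le> C (1 - |x|)\<^bsup>-m\<^esup>\<close> with \<open>m\<close> depending only on \<open>A\<close>.
\<close>

section \<open>Radial segments and the \<rho>-distance from the origin\<close>

text \<open>A segment is traversed at constant speed, so the chord sum of a monotone subdivision
  telescopes to \<open>(t k - t 0) * dist x y\<close>. The subdivision consisting of
  \<open>a\<close> and \<open>b\<close> alone attains the supremum.\<close>

lemma arc_length_linepath:
  fixes x y :: "'a::real_normed_vector"
  assumes "a \<le> b"
  shows "arc_length (linepath x y) a b = ennreal ((b - a) * dist x y)"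
proof -
  have d: "dist (linepath x y u) (linepath x y v) = \<bar>u - v\<bar> * dist x y" for u v :: real
  proof -
    have "linepath x y u - linepath x y v = (u - v) *\<^sub>R (y - x)"
      by (simp add: linepath_def algebra_simps)
    then show ?thesis
      by (simp add: dist_norm norm_minus_commute)
  qed
  show ?thesis
    unfolding arc_length_def
  proof (intro antisym SUP_least)
    fix kt :: "nat \<times> (nat \<Rightarrow> real)"
    assume "kt \<in> {(k, t). mono_on {..k} t \<and> t ` {..k} \<subseteq> {a..b}}"
    then obtain k t where kt: "kt = (k, t)" and mono: "mono_on {..k} t" and ran: "t ` {..k} \<subseteq> {a..b}"
      by auto
    have "(\<Sum>i<k. ennreal (dist (linepath x y (t i)) (linepath x y (t (Suc i)))))
        = (\<Sum>i<k. ennreal ((t (Suc i) - t i) * dist x y))"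
      using mono by (intro sum.cong) (auto simp: d mono_on_def)
    also have "\<dots> = ennreal (\<Sum>i<k. (t (Suc i) - t i) * dist x y)"
      using mono by (intro sum_ennreal) (auto simp: mono_on_def)
    also have "(\<Sum>i<k. (t (Suc i) - t i) * dist x y) = (t k - t 0) * dist x y"
      by (simp only: sum_distrib_right[symmetric] sum_lessThan_telescope)
    also have "ennreal ((t k - t 0) * dist x y) \<le> ennreal ((b - a) * dist x y)"
    proof -
      have "t k \<in> {a..b}" "t 0 \<in> {a..b}"
        using ran by (auto simp: image_subset_iff)
      then show ?thesis
        by (intro ennreal_leI mult_right_mono) auto
    qed
    finally show "(case kt of (k, t) \<Rightarrow>
        \<Sum>i<k. ennreal (dist (linepath x y (t i)) (linepath x y (t (Suc i))))) \<le> ennreal ((b - a) * dist x y)"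
      by (simp add: kt)
  next
    define t where "t = (\<lambda>i::nat. if i = 0 then a else b)"
    have "(1, t) \<in> {(k, t). mono_on {..k} t \<and> t ` {..k} \<subseteq> {a..b}}"
      using assms by (auto simp: t_def mono_on_def)
    then show "ennreal ((b - a) * dist x y) \<le>
        (SUP (k, t) \<in> {(k, t). mono_on {..k} t \<and> t ` {..k} \<subseteq> {a..b}}.
          \<Sum>i<k. ennreal (dist (linepath x y (t i)) (linepath x y (t (Suc i)))))"
      by (rule SUP_upper2) (use assms in \<open>simp add: d t_def\<close>)
  qed
qed

text \<open>The length function of the segment is \<open>u * t\<close>, which is injective on
  [0, 1]. Hence \<open>inv_into\<close> has to return \<open>s / t\<close>, and the arc length
  parametrization is the ray \<open>s *\<^sub>R \<omega>\<close> itself.\<close>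

lemma weighted_length_linepath_origin:
  fixes \<omega> :: "'a::real_normed_vector"
  assumes "norm \<omega> = 1" "0 < t"
  shows "weighted_length \<rho> (linepath 0 (t *\<^sub>R \<omega>)) = (\<integral>\<^sup>+s\<in>{0..t}. ennreal (\<rho> (s *\<^sub>R \<omega>)) \<partial>lborel)"
proof -
  let ?g = "linepath 0 (t *\<^sub>R \<omega>)"
  have len: "arc_length ?g 0 u = ennreal (u * t)" if "0 \<le> u" for u
    using that assms by (simp add: arc_length_linepath)
  have "arc_length_param ?g s = s *\<^sub>R \<omega>" if s: "s \<in> {0..t}" for s
  proof -
    have inj: "inj_on (\<lambda>u. enn2real (arc_length ?g 0 u)) {0..1}"
      using assms by (auto simp: inj_on_def len)
    have "enn2real (arc_length ?g 0 (s / t)) = s"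
      using s assms by (simp add: len)
    then have "inv_into {0..1} (\<lambda>u. enn2real (arc_length ?g 0 u)) s = s / t"
      using s assms by (intro inv_into_f_eq[OF inj]) auto
    then show ?thesis
      using assms by (simp add: arc_length_param_def linepath_def)
  qed
  then have "(\<integral>\<^sup>+s\<in>{0..t}. ennreal (\<rho> (arc_length_param ?g s)) \<partial>lborel)
      = (\<integral>\<^sup>+s\<in>{0..t}. ennreal (\<rho> (s *\<^sub>R \<omega>)) \<partial>lborel)"
    by (intro nn_integral_cong) (simp split: split_indicator)
  then show ?thesis
    using assms by (simp add: weighted_length_def len)
qed

text \<open>The segment is one competitor in the infimum. This bound places the sets of small radial
  length inside \<rho>-balls about 0, where volume growth applies.\<close>

lemma density_dist_origin_le:
  fixes \<omega> :: "real^'n"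
  assumes "norm \<omega> = 1" "0 < t" "t < 1"
  shows "density_dist \<rho> 0 (t *\<^sub>R \<omega>) \<le> (\<integral>\<^sup>+s\<in>{0..t}. ennreal (\<rho> (s *\<^sub>R \<omega>)) \<partial>lborel)"
proof -
  have "path_image (linepath 0 (t *\<^sub>R \<omega>)) \<subseteq> ball 0 1"
    unfolding path_image_linepath by (rule closed_segment_subset) (use assms in auto)
  then show ?thesis
    unfolding density_dist_def weighted_length_linepath_origin[OF assms(1,2), symmetric]
    by (intro INF_lower) auto
qed

section \<open>Surface measure and integration over rays\<close>

lemma emeasure_sphere_measure_finite:
  "emeasure (sphere_measure :: (real^'n) measure) (sphere 0 1) < \<infinity>"
proof -
  let ?C = "{r *\<^sub>R \<omega> |r \<omega>. 0 < r \<and> r < 1 \<and> \<omega> \<in> sphere 0 (1::real)} :: (real^'n) set"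
  have "emeasure lborel ?C \<le> emeasure lborel (ball 0 1 :: (real^'n) set)"
    by (intro emeasure_mono) auto
  also have "\<dots> < \<infinity>"
    by (rule emeasure_bounded_finite) simp
  finally show ?thesis
    by (subst emeasure_sphere_measure) (auto simp: ennreal_mult_less_top of_nat_less_top)
qed

lemma nn_integral_sphere_measure:
  fixes G :: "real^'n \<Rightarrow> ennreal"
  assumes "G \<in> borel_measurable borel"
  shows "(\<integral>\<^sup>+\<omega>. G \<omega> \<partial>sphere_measure)
    = of_nat CARD('n) * (\<integral>\<^sup>+x\<in>ball 0 1 - {0}. G (x /\<^sub>R norm x) \<partial>lborel)"
proof -
  have meas: "(\<lambda>x::real^'n. x /\<^sub>R norm x) \<in>
      restrict_space lborel (ball 0 1 - {0}) \<rightarrow>\<^sub>M restrict_space borel (sphere 0 1)"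
    by (intro measurable_restrict_space2 measurable_restrict_space1)
       (auto simp: space_restrict_space)
  have G: "G \<in> borel_measurable (restrict_space borel (sphere 0 1))"
    using assms by (rule measurable_restrict_space1)
  show ?thesis
    unfolding sphere_measure_def
    using G by (simp add: nn_integral_scale_measure nn_integral_distr[OF meas] nn_integral_restrict_space)
qed

lemma nn_integral_lborel_scaleR:
  fixes F :: "'a::euclidean_space \<Rightarrow> ennreal"
  assumes [measurable]: "F \<in> borel_measurable borel" and c: "0 < c"
  shows "(\<integral>\<^sup>+x. F (c *\<^sub>R x) \<partial>lborel) = ennreal ((1 / c) ^ DIM('a)) * (\<integral>\<^sup>+x. F x \<partial>lborel)"
proof -
  have "(\<integral>\<^sup>+x. F x \<partial>lborel) = (\<integral>\<^sup>+x. F x \<partial>density (distr lborel borel (\<lambda>x. 0 + c *\<^sub>R x)) (\<lambda>_. \<bar>c\<bar> ^ DIM('a)))"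
    using c by (subst lborel_affine[of c 0]) auto
  also have "\<dots> = ennreal (c ^ DIM('a)) * (\<integral>\<^sup>+x. F (c *\<^sub>R x) \<partial>lborel)"
    using c by (simp add: nn_integral_density nn_integral_distr nn_integral_cmult)
  finally show ?thesis
    using c by (simp add: mult.assoc[symmetric] ennreal_mult[symmetric] power_mult_distrib[symmetric])
qed

text \<open>The substitution \<open>t = \<tau> |x|\<close> in the inner integral and Fubini replace polar coordinates.\<close>

lemma nn_integral_sphere_measure_radial_le:
  fixes F :: "real^'n \<Rightarrow> ennreal"
  assumes F[measurable]: "F \<in> borel_measurable borel"
  shows "(\<integral>\<^sup>+\<omega>. (\<integral>\<^sup>+t\<in>{1/2<..<1}. F (t *\<^sub>R \<omega>) \<partial>lborel) \<partial>sphere_measure)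
    \<le> of_nat CARD('n) * (\<integral>\<^sup>+\<tau>\<in>{1/2..}. ennreal ((1 / \<tau>) ^ CARD('n)) \<partial>lborel) * (\<integral>\<^sup>+y\<in>ball 0 1. F y \<partial>lborel)"
proof -
  let ?H = "\<lambda>y. F y * indicator (ball 0 1) y"
  have H[measurable]: "?H \<in> borel_measurable borel"
    using F by (intro borel_measurable_times_ennreal borel_measurable_indicator) auto
  have [measurable]: "(\<lambda>(\<tau>, x). ?H (\<tau> *\<^sub>R x) * indicator {1/2..} \<tau>) \<in> borel_measurable (lborel \<Otimes>\<^sub>M lborel)"
  proof -
    have [measurable]: "indicator {1/2::real..} \<in> borel_measurable borel"
      by (rule borel_measurable_indicator) simp
    have "(\<lambda>p. ?H (fst p *\<^sub>R snd p) * indicator {1/2..} (fst p)) \<in> borel_measurable (borel \<Otimes>\<^sub>M borel)"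
      by (intro borel_measurable_times_ennreal measurable_compose[OF _ H] measurable_compose[of fst _ borel "indicator {1/2..}"])
        measurable
    then show ?thesis
      by (simp add: case_prod_beta cong: measurable_cong_sets)
  qed
  define G where "G \<omega> = (\<integral>\<^sup>+t\<in>{1/2<..<1}. F (t *\<^sub>R \<omega>) \<partial>lborel)" for \<omega> :: "real^'n"
  have [measurable]: "G \<in> borel_measurable borel"
    unfolding G_def by measurable
  have "G (x /\<^sub>R norm x) * indicator (ball 0 1 - {0}) x
      \<le> (\<integral>\<^sup>+\<tau>\<in>{1/2..}. ?H (\<tau> *\<^sub>R x) \<partial>lborel)" for x :: "real^'n"
  proof (cases "x \<in> ball 0 1 - {0}")
    case True
    then have x: "0 < norm x" "norm x < 1" by auto
    have "G (x /\<^sub>R norm x) = ennreal \<bar>norm x\<bar> * (\<integral>\<^sup>+\<tau>. F ((0 + norm x * \<tau>) *\<^sub>R (x /\<^sub>R norm x))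
        * indicator {1/2<..<1} (0 + norm x * \<tau>) \<partial>lborel)"
      unfolding G_def using x by (intro nn_integral_real_affine) auto
    also have "\<dots> \<le> 1 * (\<integral>\<^sup>+\<tau>. F ((0 + norm x * \<tau>) *\<^sub>R (x /\<^sub>R norm x))
        * indicator {1/2<..<1} (0 + norm x * \<tau>) \<partial>lborel)"
      using x by (intro mult_right_mono) (auto simp: ennreal_le_1)
    also have "\<dots> \<le> (\<integral>\<^sup>+\<tau>\<in>{1/2..}. ?H (\<tau> *\<^sub>R x) \<partial>lborel)"
      unfolding mult_1
    proof (intro nn_integral_mono)
      fix \<tau> :: real
      \<comment> \<open>Since |x| < 1, the lower limit 1/2 for t is inherited by \<tau>. The upper
        limit t < 1 turns into the cut-off |\<tau> x| < 1 in \<open>?H\<close>; as |x| may be small,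
        \<tau> itself ranges over a half-line.\<close>
      have "1/2 \<le> \<tau> \<and> norm (\<tau> *\<^sub>R x) < 1" if *: "1/2 < norm x * \<tau>" "norm x * \<tau> < 1"
      proof -
        have "0 < norm x * \<tau>" using * by linarith
        then have "0 < \<tau>" using x by (simp add: zero_less_mult_iff)
        then have "norm x * \<tau> \<le> 1 * \<tau>" using x by (intro mult_right_mono) auto
        with * \<open>0 < \<tau>\<close> show ?thesis by (simp add: abs_of_pos mult.commute[of \<tau>])
      qed
      moreover have "(0 + norm x * \<tau>) *\<^sub>R (x /\<^sub>R norm x) = \<tau> *\<^sub>R x"
        using x by simp
      ultimately show "F ((0 + norm x * \<tau>) *\<^sub>R (x /\<^sub>R norm x)) * indicator {1/2<..<1} (0 + norm x * \<tau>)
          \<le> ?H (\<tau> *\<^sub>R x) * indicator {1/2..} \<tau>"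
        by (simp only:) (auto split: split_indicator)
    qed
    finally show ?thesis using True by simp
  qed simp
  then have "(\<integral>\<^sup>+x\<in>ball 0 1 - {0}. G (x /\<^sub>R norm x) \<partial>lborel)
      \<le> (\<integral>\<^sup>+x. (\<integral>\<^sup>+\<tau>\<in>{1/2..}. ?H (\<tau> *\<^sub>R x) \<partial>lborel) \<partial>lborel)"
    by (rule nn_integral_mono)
  also have "\<dots> = (\<integral>\<^sup>+\<tau>. (\<integral>\<^sup>+x. ?H (\<tau> *\<^sub>R x) * indicator {1/2..} \<tau> \<partial>lborel) \<partial>lborel)"
    by (rule lborel_pair.Fubini') measurable
  \<comment> \<open>For fixed \<tau> the substitution y = \<tau> x contributes the Jacobian
    \<tau>^(-n) and leaves an integral that is independent of \<tau>.\<close>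
  also have "\<dots> = (\<integral>\<^sup>+\<tau>. ennreal ((1 / \<tau>) ^ CARD('n)) * indicator {1/2..} \<tau> * (\<integral>\<^sup>+y. ?H y \<partial>lborel) \<partial>lborel)"
  proof (intro nn_integral_cong)
    fix \<tau> :: real
    show "(\<integral>\<^sup>+x. ?H (\<tau> *\<^sub>R x) * indicator {1/2..} \<tau> \<partial>lborel)
        = ennreal ((1 / \<tau>) ^ CARD('n)) * indicator {1/2..} \<tau> * (\<integral>\<^sup>+y. ?H y \<partial>lborel)"
    proof (cases "1/2 \<le> \<tau>")
      case True
      then show ?thesis
        using nn_integral_lborel_scaleR[of ?H \<tau>] by simp
    qed simp
  qed
  also have "\<dots> = (\<integral>\<^sup>+\<tau>\<in>{1/2..}. ennreal ((1 / \<tau>) ^ CARD('n)) \<partial>lborel) * (\<integral>\<^sup>+y. ?H y \<partial>lborel)"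
    by (intro nn_integral_multc) measurable
  finally show ?thesis
    unfolding G_def[symmetric]
    by (subst nn_integral_sphere_measure) (auto simp: mult.assoc intro: mult_left_mono)
qed

text \<open>This is the constant in \<open>nn_integral_sphere_measure_radial_le\<close>. The
  antiderivative -\<tau>^(1-n)/(n-1) vanishes at infinity because n \<ge> 2; the singularity at 0 is
  avoided because the rays start at t = 1/2.\<close>

lemma nn_integral_inverse_power_finite:
  assumes "2 \<le> n"
  shows "(\<integral>\<^sup>+\<tau>\<in>{1/2..}. ennreal ((1 / \<tau>) ^ n) \<partial>lborel) < \<infinity>"
proof -
  obtain k where k: "n = Suc (Suc k)"
    using assms by (metis Suc_le_D numeral_2_eq_2 Suc_le_mono)
  let ?F = "\<lambda>\<tau>::real. - ((1 / \<tau>) ^ Suc k / real (Suc k))"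
  have "(\<integral>\<^sup>+\<tau>\<in>{1/2..}. ennreal ((1 / \<tau>) ^ n) \<partial>lborel) = ennreal (0 - ?F (1 / 2))"
  proof (rule nn_integral_FTC_atLeast)
    fix \<tau> :: real assume "1/2 \<le> \<tau>"
    have "((\<lambda>\<tau>. inverse \<tau> ^ Suc k / real (Suc k)) has_real_derivative
        (real (Suc k) * inverse \<tau> ^ k * (- (inverse \<tau> * inverse \<tau>))) / real (Suc k)) (at \<tau>)"
      using \<open>1/2 \<le> \<tau>\<close> by (intro derivative_eq_intros | simp)+
    then have "((\<lambda>\<tau>. inverse \<tau> ^ Suc k / real (Suc k)) has_real_derivative - (inverse \<tau> ^ n)) (at \<tau>)"
      by (simp add: k mult_ac del: of_nat_Suc)
    then show "(?F has_real_derivative (1 / \<tau>) ^ n) (at \<tau>)"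
      unfolding inverse_eq_divide[symmetric] by (auto dest: DERIV_minus)
  next
    have "(?F \<longlongrightarrow> - (0 ^ Suc k / real (Suc k))) at_top"
      unfolding inverse_eq_divide[symmetric]
      by (intro tendsto_minus tendsto_divide tendsto_power tendsto_inverse_0_at_top filterlim_ident
          tendsto_const) simp
    then show "(?F \<longlongrightarrow> 0) at_top"
      by simp
  qed auto
  then show ?thesis by simp
qed

section \<open>The radial length function\<close>

text \<open>The cut-off to the ball makes \<open>radial_length \<rho>\<close> Borel measurable on the whole space.\<close>

definition radial_length :: "('a::euclidean_space \<Rightarrow> real) \<Rightarrow> 'a \<Rightarrow> real" where
  "radial_length \<rho> x =
     (\<integral>s. (if 0 \<le> s \<and> s \<le> norm x
           then indicator (ball 0 1) (s *\<^sub>R (x /\<^sub>R norm x)) *\<^sub>R \<rho> (s *\<^sub>R (x /\<^sub>R norm x)) else 0) \<partial>lborel)"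

lemma borel_measurable_ball_density:
  fixes \<rho> :: "'a::euclidean_space \<Rightarrow> real"
  assumes "continuous_on (ball 0 1) \<rho>"
  shows "(\<lambda>x. indicator (ball 0 1) x *\<^sub>R \<rho> x) \<in> borel_measurable borel"
  using assms by (intro borel_measurable_continuous_on_indicator) auto

lemma borel_measurable_radial_length:
  fixes \<rho> :: "'a::euclidean_space \<Rightarrow> real"
  assumes "continuous_on (ball 0 1) \<rho>"
  shows "radial_length \<rho> \<in> borel_measurable borel"
proof -
  note [measurable] = borel_measurable_ball_density[OF assms]
  show ?thesis
    unfolding radial_length_def by measurable
qed

lemma continuous_on_ray:
  fixes \<omega> :: "'a::euclidean_space"
  assumes "continuous_on (ball 0 1) \<rho>" "norm \<omega> = 1" "t < 1"
  shows "continuous_on {0..t} (\<lambda>s. \<rho> (s *\<^sub>R \<omega>))"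
  by (rule continuous_on_compose2[OF assms(1)]) (use assms in \<open>auto intro!: continuous_intros\<close>)

text \<open>The first form can be differentiated in t, the second compared with
  \<open>density_dist\<close>. They agree because \<rho> is positive and continuous on the compact
  segment, so the Bochner integral in the definition is a genuine one and not the default value
  0.\<close>

lemma radial_length_ray:
  fixes \<omega> :: "'a::euclidean_space"
  assumes cont: "continuous_on (ball 0 1) \<rho>" and pos: "\<forall>x\<in>ball 0 1. 0 < \<rho> x"
    and \<omega>: "norm \<omega> = 1" and t: "0 < t" "t < 1"
  shows "radial_length \<rho> (t *\<^sub>R \<omega>) = integral {0..t} (\<lambda>s. \<rho> (s *\<^sub>R \<omega>))" (is ?real)
    and "ennreal (radial_length \<rho> (t *\<^sub>R \<omega>)) = (\<integral>\<^sup>+s\<in>{0..t}. ennreal (\<rho> (s *\<^sub>R \<omega>)) \<partial>lborel)" (is ?ennreal)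
proof -
  let ?f = "\<lambda>s. indicator {0..t} s *\<^sub>R \<rho> (s *\<^sub>R \<omega>)"
  have int: "set_integrable lborel {0..t} (\<lambda>s. \<rho> (s *\<^sub>R \<omega>))"
    using continuous_on_ray[OF cont \<omega> t(2)] by (rule borel_integrable_atLeastAtMost')
  have eq: "radial_length \<rho> (t *\<^sub>R \<omega>) = (LINT s:{0..t}|lborel. \<rho> (s *\<^sub>R \<omega>))"
    unfolding radial_length_def set_lebesgue_integral_def
    using \<omega> t by (intro Bochner_Integration.integral_cong) (auto simp: indicator_def)
  then show ?real
    using set_borel_integral_eq_integral(2)[OF int] by simp
  have "(\<integral>\<^sup>+s. ennreal (?f s) \<partial>lborel) = ennreal (LINT s:{0..t}|lborel. \<rho> (s *\<^sub>R \<omega>))"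
    unfolding set_lebesgue_integral_def
  proof (rule nn_integral_eq_integral)
    show "integrable lborel ?f"
      using int by (simp add: set_integrable_def)
    show "AE s in lborel. 0 \<le> ?f s"
      using pos \<omega> t by (auto intro!: less_imp_le split: split_indicator)
  qed
  moreover have "(\<integral>\<^sup>+s. ennreal (?f s) \<partial>lborel) = (\<integral>\<^sup>+s\<in>{0..t}. ennreal (\<rho> (s *\<^sub>R \<omega>)) \<partial>lborel)"
    by (intro nn_integral_cong) (simp split: split_indicator)
  ultimately show ?ennreal
    using eq by simp
qed

lemma radial_length_nonneg:
  assumes "\<forall>x\<in>ball 0 1. 0 < \<rho> x"
  shows "0 \<le> radial_length \<rho> x"
  unfolding radial_length_def
  using assms by (intro Bochner_Integration.integral_nonneg) (auto intro: less_imp_le split: split_indicator)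

section \<open>Polynomial growth along rays from the Harnack inequality\<close>

text \<open>One Harnack step on a Whitney ball costs a factor A and shrinks the distance to the
  sphere by the factor 3/4, which is admissible because it exceeds 1/2. So k steps from the origin
  reach every point at distance at least (3/4)^k from the sphere.\<close>

lemma harnack_along_ray:
  fixes \<omega> :: "real^'n"
  assumes "harnack_ineq A \<rho>" "\<forall>x\<in>ball 0 1. 0 < \<rho> x" "1 \<le> A" "norm \<omega> = 1"
  shows "0 \<le> t \<Longrightarrow> (3/4) ^ k \<le> 1 - t \<Longrightarrow> \<rho> (t *\<^sub>R \<omega>) \<le> A ^ k * \<rho> 0"
proof (induction k arbitrary: t)
  case 0
  then show ?case by simp
next
  case (Suc k)
  \<comment> \<open>The preceding point of the chain satisfies 1 - s = (4/3)(1 - t). For t < 1/4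
    this would overshoot the origin, so s is then 0, and t lies within the radius 1/2 of its Whitney
    ball.\<close>
  define s where "s = max 0 (1 - (1 - t) * (4/3))"
  have t1: "t < 1"
    using Suc.prems zero_less_power[of "3/4::real" "Suc k"] by linarith
  have s: "0 \<le> s" "s < 1" "s \<le> t" "t - s < (1 - s) / 2"
    using Suc.prems t1 by (auto simp: s_def max_def field_simps)
  have "(3/4) ^ k \<le> (1::real)"
    by (intro power_le_one) auto
  then have "(3/4) ^ k \<le> 1 - s"
    using Suc.prems by (auto simp: s_def max_def)
  then have IH: "\<rho> (s *\<^sub>R \<omega>) \<le> A ^ k * \<rho> 0"
    using s by (intro Suc.IH) auto
  have "dist (s *\<^sub>R \<omega>) (t *\<^sub>R \<omega>) = t - s"
    using s assms(4) by (simp add: dist_norm scaleR_diff_left[symmetric])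
  then have "t *\<^sub>R \<omega> \<in> whitney_ball (s *\<^sub>R \<omega>)" "s *\<^sub>R \<omega> \<in> whitney_ball (s *\<^sub>R \<omega>)" "s *\<^sub>R \<omega> \<in> ball 0 1"
    using s assms(4) by (auto simp: whitney_ball_def)
  moreover from this(3) have "0 < \<rho> (s *\<^sub>R \<omega>)"
    using assms(2) by auto
  ultimately have "\<rho> (t *\<^sub>R \<omega>) \<le> A * \<rho> (s *\<^sub>R \<omega>)"
    using assms(1) unfolding harnack_ineq_def by (metis pos_divide_le_eq)
  also have "\<dots> \<le> A * (A ^ k * \<rho> 0)"
    using IH assms(3) by (intro mult_left_mono) auto
  finally show ?case by simp
qed

text \<open>The number of steps k is logarithmic in 1/(1 - t), so the exponential cost A^k is
  polynomial: A^k \<le> ((4/3)^m)^k = ((4/3)^k)^m, and (4/3)^k is comparable with 1/(1 - t) for the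
  least possible k.\<close>

lemma harnack_growth:
  fixes \<omega> :: "real^'n"
  assumes "harnack_ineq A \<rho>" "\<forall>x\<in>ball 0 1. 0 < \<rho> x" "1 \<le> A" "A \<le> (4/3) ^ m"
    and "norm \<omega> = 1" "0 \<le> t" "t < 1"
  shows "\<rho> (t *\<^sub>R \<omega>) \<le> (4/3) ^ m * \<rho> 0 / (1 - t) ^ m"
proof -
  have "\<exists>k. (3/4) ^ k \<le> 1 - t"
    using real_arch_pow_inv[of "1 - t" "3/4"] assms(7) by (auto intro: less_imp_le)
  then obtain k where k: "(3/4) ^ k \<le> 1 - t" and least: "\<forall>j<k. \<not> (3/4) ^ j \<le> 1 - t"
    using exists_least_iff[of "\<lambda>k. (3/4) ^ k \<le> 1 - t"] by blast
  \<comment> \<open>By minimality k - 1 steps fall short, so 1 - t < (3/4)^(k-1). The surplus step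
    accounts for the constant 4/3.\<close>
  have pow: "(4/3) ^ k * (1 - t) \<le> 4/3"
  proof (cases k)
    case 0
    then show ?thesis using assms by simp
  next
    case (Suc j)
    then have "1 - t < (3/4) ^ j"
      using least by (meson lessI not_less)
    then have "(4/3) ^ k * (1 - t) \<le> (4/3) ^ k * (3/4) ^ j"
      by (intro mult_left_mono) auto
    also have "\<dots> = 4/3"
      by (simp add: Suc mult.assoc power_mult_distrib[symmetric])
    finally show ?thesis .
  qed
  have \<rho>0: "0 \<le> \<rho> 0"
    using assms(2) by (simp add: less_imp_le)
  have "\<rho> (t *\<^sub>R \<omega>) \<le> A ^ k * \<rho> 0"
    by (rule harnack_along_ray[OF assms(1-3,5,6) k])
  also have "\<dots> \<le> ((4/3) ^ m) ^ k * \<rho> 0"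
    using assms \<rho>0 by (intro mult_right_mono power_mono) auto
  also have "\<dots> = ((4/3) ^ k) ^ m * \<rho> 0"
    by (metis power_mult mult.commute)
  also have "\<dots> \<le> ((4/3) / (1 - t)) ^ m * \<rho> 0"
  proof (intro mult_right_mono power_mono)
    show "(4/3) ^ k \<le> (4/3) / (1 - t)"
      by (rule iffD2[OF pos_le_divide_eq pow]) (use assms in simp)
  qed (use \<rho>0 in auto)
  finally show ?thesis
    by (simp only: power_divide[of "4/3" "1 - t"] times_divide_eq_left)
qed

text \<open>The bound for \<rho> increases along the ray, so its value at t times the length t < 1
  of the segment suffices.\<close>

lemma radial_length_growth:
  fixes \<omega> :: "real^'n"
  assumes cont: "continuous_on (ball 0 1) \<rho>" and pos: "\<forall>x\<in>ball 0 1. 0 < \<rho> x"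
    and "harnack_ineq A \<rho>" "1 \<le> A" "A \<le> (4/3) ^ m" "norm \<omega> = 1" "0 < t" "t < 1"
  shows "radial_length \<rho> (t *\<^sub>R \<omega>) \<le> (4/3) ^ m * \<rho> 0 / (1 - t) ^ m"
proof -
  let ?M = "(4/3) ^ m * \<rho> 0 / (1 - t) ^ m"
  have \<rho>0: "0 \<le> \<rho> 0"
    using pos by (simp add: less_imp_le)
  then have M: "0 \<le> ?M"
    using assms by (intro divide_nonneg_nonneg mult_nonneg_nonneg) auto
  have "norm (integral {0..t} (\<lambda>s. \<rho> (s *\<^sub>R \<omega>))) \<le> ?M * (t - 0)"
  proof (rule integral_bound)
    fix s assume s: "s \<in> {0..t}"
    have "\<rho> (s *\<^sub>R \<omega>) \<le> (4/3) ^ m * \<rho> 0 / (1 - s) ^ m"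
      using assms s by (intro harnack_growth) auto
    also have "\<dots> \<le> ?M"
      using assms s \<rho>0 by (intro divide_left_mono power_mono mult_pos_pos) auto
    finally show "norm (\<rho> (s *\<^sub>R \<omega>)) \<le> ?M"
      using pos assms s by (simp add: abs_of_pos)
  qed (use continuous_on_ray assms in auto)
  also have "\<dots> \<le> ?M * 1"
    using M assms by (intro mult_left_mono) auto
  finally show ?thesis
    using assms by (simp add: radial_length_ray(1)[OF cont pos])
qed

section \<open>Integrability of the two terms from Young's inequality\<close>

text \<open>The reflection u = 1 - t reduces this to a power at 0. It is applied with q = 4pm, and
  the condition q < 1 determines how small p must be.\<close>

lemma nn_integral_one_minus_powr_finite:
  fixes q :: real
  assumes "q < 1"
  shows "(\<integral>\<^sup>+t\<in>{0<..<1}. ennreal ((1 - t) powr - q) \<partial>lborel) < \<infinity>"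
proof -
  have "(\<integral>\<^sup>+t\<in>{0<..<1}. ennreal ((1 - t) powr - q) \<partial>lborel)
      = ennreal \<bar>-1\<bar> * (\<integral>\<^sup>+u. ennreal ((1 - (1 + (-1) * u)) powr - q) * indicator {0<..<1} (1 + (-1) * u) \<partial>lborel)"
    by (rule nn_integral_real_affine) auto
  also have "\<dots> \<le> (\<integral>\<^sup>+u. ennreal (indicator {0..1} u * u powr - q) \<partial>lborel)"
    by (simp, intro nn_integral_mono) (auto split: split_indicator)
  also have "\<dots> = ennreal (1 powr (- q + 1) / (- q + 1))"
    using assms by (intro nn_integral_has_integral_lebesgue has_integral_powr_from_0) auto
  also have "\<dots> < \<infinity>"
    by simp
  finally show ?thesis .
qed

text \<open>The ball is decomposed into the dyadic shells \<open>2\<^sup>i \<le> 1 + R < 2\<^bsup>i+1\<^esup>\<close> of the radial length \<open>R\<close>.\<close>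

lemma volume_growth_weighted:
  fixes \<rho> :: "real^'n \<Rightarrow> real"
  assumes cont: "continuous_on (ball 0 1) \<rho>" and pos: "\<forall>x\<in>ball 0 1. 0 < \<rho> x"
    and vol: "volume_growth B \<rho>" and "0 < B" and q: "real CARD('n) < q"
  shows "(\<integral>\<^sup>+y\<in>ball 0 1. ennreal (\<rho> y ^ CARD('n) * (1 + radial_length \<rho> y) powr - q) \<partial>lborel) < \<infinity>"
proof -
  let ?n = "CARD('n)" and ?R = "radial_length \<rho>"
  \<comment> \<open>Sublevel sets replace the shells: overcounting is harmless for an upper bound,
    and the lower shell bound enters only through the weight \<open>a i\<close>. The origin has no
    direction and is removed as a null set.\<close>
  define E where "E i = {y \<in> ball 0 1 - {0}. ?R y < 2 ^ Suc i}" for i :: nat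
  define a where "a i = (2 ^ i) powr - q" for i :: nat
  define b where "b i = a i * (B * (2 ^ Suc i) ^ ?n)" for i :: nat
  note [measurable] = borel_measurable_radial_length[OF cont]
  have [measurable]: "E i \<in> sets borel" for i
    unfolding E_def by measurable
  have [measurable]: "(\<lambda>y. ennreal (\<rho> y ^ ?n) * indicator (E i) y) \<in> borel_measurable borel" for i
  proof -
    note [measurable] = borel_measurable_ball_density[OF cont]
    have eq: "(\<lambda>y. ennreal (\<rho> y ^ ?n) * indicator (E i) y)
        = (\<lambda>y. ennreal ((indicator (ball 0 1) y *\<^sub>R \<rho> y) ^ ?n) * indicator (E i) y)"
      by (auto simp: E_def fun_eq_iff split: split_indicator)
    show ?thesis unfolding eq by measurable
  qed
  have ball: "(\<integral>\<^sup>+y\<in>E i. ennreal (\<rho> y ^ ?n) \<partial>lborel) \<le> ennreal (B * (2 ^ Suc i) ^ ?n)" for i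
  proof -
    have "E i \<subseteq> density_ball \<rho> 0 (2 ^ Suc i)"
    proof
      fix y assume y: "y \<in> E i"
      define \<omega> where "\<omega> = y /\<^sub>R norm y"
      have \<omega>: "norm \<omega> = 1" "y = norm y *\<^sub>R \<omega>" "0 < norm y" "norm y < 1"
        using y by (auto simp: E_def \<omega>_def)
      then have "density_dist \<rho> 0 y \<le> ennreal (?R y)"
        using density_dist_origin_le[of \<omega> "norm y" \<rho>] radial_length_ray(2)[OF cont pos, of \<omega> "norm y"] by simp
      also have "\<dots> < ennreal (2 ^ Suc i)"
        using y radial_length_nonneg[OF pos] by (auto simp: E_def ennreal_less_iff)
      finally show "y \<in> density_ball \<rho> 0 (2 ^ Suc i)"
        using y by (auto simp: density_ball_def E_def)
    qed
    then have "(\<integral>\<^sup>+y\<in>E i. ennreal (\<rho> y ^ ?n) \<partial>lborel)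
        \<le> (\<integral>\<^sup>+y\<in>density_ball \<rho> 0 (2 ^ Suc i). ennreal (\<rho> y ^ ?n) \<partial>lborel)"
      by (intro nn_integral_mono) (auto split: split_indicator)
    also have "\<dots> \<le> ennreal (B * (2 ^ Suc i) ^ ?n)"
      using vol unfolding volume_growth_def by (auto simp del: power_Suc)
    finally show ?thesis .
  qed
  have pointwise: "ennreal (\<rho> y ^ ?n * (1 + ?R y) powr - q) \<le> (\<Sum>i. ennreal (a i) * (ennreal (\<rho> y ^ ?n) * indicator (E i) y))"
    if y: "y \<in> ball 0 1" "y \<noteq> 0" for y
  proof -
    have R: "0 \<le> ?R y"
      by (rule radial_length_nonneg[OF pos])
    \<comment> \<open>The least such i also satisfies 2^i \<le> 1 + R, which identifies the shell of
      y. The i-th term alone then dominates the integrand.\<close>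
    have "\<exists>i. 1 + ?R y < 2 ^ Suc i"
      using real_arch_pow[of 2 "1 + ?R y"] power_strict_increasing[of _ "Suc _" "2::real"] by (metis lessI less_trans one_less_numeral_iff semiring_norm(76))
    then obtain i where i: "1 + ?R y < 2 ^ Suc i" and least: "\<forall>j<i. \<not> 1 + ?R y < 2 ^ Suc j"
      using exists_least_iff[of "\<lambda>i. 1 + ?R y < 2 ^ Suc i"] by blast
    have "2 ^ i \<le> 1 + ?R y"
    proof (cases i)
      case (Suc j)
      then show ?thesis using least by (meson lessI not_less)
    qed (use R in simp)
    then have "(1 + ?R y) powr - q \<le> a i"
      unfolding a_def using q by (intro powr_mono2') auto
    moreover have \<rho>y: "0 \<le> \<rho> y"
      using pos y by (auto intro: less_imp_le)
    ultimately have "\<rho> y ^ ?n * (1 + ?R y) powr - q \<le> \<rho> y ^ ?n * a i"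
      by (intro mult_left_mono) auto
    then have "ennreal (\<rho> y ^ ?n * (1 + ?R y) powr - q) \<le> ennreal (a i) * ennreal (\<rho> y ^ ?n)"
      using \<rho>y by (simp add: ennreal_mult[symmetric] a_def mult.commute ennreal_leI)
    also have "\<dots> = (\<Sum>j\<in>{i}. ennreal (a j) * (ennreal (\<rho> y ^ ?n) * indicator (E j) y))"
      using y i by (simp add: E_def)
    also have "\<dots> \<le> (\<Sum>j. ennreal (a j) * (ennreal (\<rho> y ^ ?n) * indicator (E j) y))"
      by (rule sum_le_suminf) auto
    finally show ?thesis .
  qed
  have "AE y::real^'n in lborel. y \<noteq> 0"
    by (rule AE_lborel_singleton)
  then have "(\<integral>\<^sup>+y\<in>ball 0 1. ennreal (\<rho> y ^ ?n * (1 + ?R y) powr - q) \<partial>lborel)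
      \<le> (\<integral>\<^sup>+y. (\<Sum>i. ennreal (a i) * (ennreal (\<rho> y ^ ?n) * indicator (E i) y)) \<partial>lborel)"
    by (intro nn_integral_mono_AE) (auto elim!: eventually_mono intro: pointwise split: split_indicator)
  also have "\<dots> = (\<Sum>i. \<integral>\<^sup>+y. ennreal (a i) * (ennreal (\<rho> y ^ ?n) * indicator (E i) y) \<partial>lborel)"
    by (intro nn_integral_suminf) measurable
  also have "\<dots> = (\<Sum>i. ennreal (a i) * (\<integral>\<^sup>+y\<in>E i. ennreal (\<rho> y ^ ?n) \<partial>lborel))"
    by (intro suminf_cong nn_integral_cmult) measurable
  also have "\<dots> \<le> (\<Sum>i. ennreal (b i))"
  proof (intro suminf_le summableI)
    fix i
    have "ennreal (b i) = ennreal (a i) * ennreal (B * (2 ^ Suc i) ^ ?n)"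
      unfolding b_def a_def using \<open>0 < B\<close> by (intro ennreal_mult) auto
    then show "ennreal (a i) * (\<integral>\<^sup>+y\<in>E i. ennreal (\<rho> y ^ ?n) \<partial>lborel) \<le> ennreal (b i)"
      by (simp only:) (intro mult_left_mono ball, simp)
  qed
  also have "\<dots> < \<infinity>"
  proof -
    \<comment> \<open>The volume of the i-th set grows like 2^(ni) while the weight decays like
      2^(-qi). The series is geometric with ratio 2^(n-q), less than 1 since q > n.\<close>
    have "b = (\<lambda>i. B * 2 ^ ?n * (2 powr (real ?n - q)) ^ i)"
    proof
      fix i
      have "a i = 2 powr (- q * real i)"
        by (simp add: a_def powr_realpow[symmetric] powr_powr mult.commute)
      moreover have "(2 ^ Suc i) ^ ?n = (2::real) ^ ?n * 2 powr (real ?n * real i)"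
        by (simp add: power_mult_distrib power_mult[symmetric] powr_realpow[symmetric] powr_powr mult.commute)
      moreover have "(2 powr (real ?n - q)) ^ i = 2 powr (- q * real i) * 2 powr (real ?n * real i)"
        by (simp add: powr_realpow[symmetric] powr_powr powr_add[symmetric] algebra_simps)
      ultimately show "b i = B * 2 ^ ?n * (2 powr (real ?n - q)) ^ i"
        by (simp add: b_def)
    qed
    moreover have "norm ((2::real) powr (real ?n - q)) < 1"
      using q powr_less_mono[of "real ?n - q" 0 2] by simp
    ultimately have "summable b"
      by (simp add: summable_mult summable_geometric)
    moreover have "0 \<le> b i" for i
      using \<open>0 < B\<close> by (simp add: b_def a_def)
    ultimately have "(\<Sum>i. ennreal (b i)) \<noteq> top"
      by (intro ennreal_suminf_neq_top)
    then show ?thesis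
      by (simp add: less_top)
  qed
  finally show ?thesis .
qed

section \<open>Powers of the radial length along a single ray\<close>

text \<open>A crude Young inequality. The exponent conjugate to n is n/(n-1) \<le> 2, and since b
  \<ge> 1 it may be raised to 2 for every n. The proof compares a with b: the larger of the two
  supplies the square.\<close>

lemma mult_le_power_add_square:
  fixes a b :: real
  assumes "0 \<le> a" "1 \<le> b" "2 \<le> n"
  shows "a * b \<le> a ^ n + b ^ 2"
proof (cases "a \<le> b")
  case True
  then have "a * b \<le> b ^ 2"
    using assms by (simp add: power2_eq_square mult_right_mono)
  then show ?thesis
    using zero_le_power[OF assms(1), of n] by linarith
next
  case False
  then have "a * b \<le> a ^ 2"
    using assms by (simp add: power2_eq_square mult_left_mono)
  also have "\<dots> \<le> a ^ n"
    using False assms by (intro power_increasing) auto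
  finally show ?thesis
    using zero_le_power2[of b] by linarith
qed

text \<open>The fundamental theorem of calculus is applied to (1 + R)^p on [1/2, T], and the
  derivative is estimated by Young's inequality. Extending the integral to (1/2, 1) makes the
  right-hand side independent of T.\<close>

lemma radial_length_powr_le:
  fixes \<omega> :: "real^'n"
  assumes cont: "continuous_on (ball 0 1) \<rho>" and pos: "\<forall>x\<in>ball 0 1. 0 < \<rho> x"
    and \<omega>: "norm \<omega> = 1" and T: "1/2 < T" "T < 1" and p: "0 < p" "p < 1" and n: "2 \<le> n"
  defines "R \<equiv> radial_length \<rho>"
  shows "ennreal ((1 + R (T *\<^sub>R \<omega>)) powr p) \<le> ennreal ((1 + R ((1/2) *\<^sub>R \<omega>)) powr p)
    + (\<integral>\<^sup>+t\<in>{1/2<..<1}. ennreal (\<rho> (t *\<^sub>R \<omega>) ^ n * (1 + R (t *\<^sub>R \<omega>)) powr - (real n * (1 + p)))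
        + ennreal ((1 + R (t *\<^sub>R \<omega>)) powr (4 * p)) \<partial>lborel)"
proof -
  define r where "r t = integral {0..t} (\<lambda>s. \<rho> (s *\<^sub>R \<omega>))" for t
  have Rr: "R (t *\<^sub>R \<omega>) = r t" if "0 < t" "t < 1" for t
    unfolding R_def r_def using radial_length_ray(1)[OF cont pos \<omega> that] .
  have r0: "0 \<le> r t" if "0 < t" "t < 1" for t
    using radial_length_nonneg[OF pos] Rr[OF that] by (metis R_def)
  define g where "g t = p * (1 + r t) powr (p - 1) * \<rho> (t *\<^sub>R \<omega>)" for t
  have deriv: "((\<lambda>t. (1 + r t) powr p) has_real_derivative g t) (at t within {1/2..T})" if t: "t \<in> {1/2..T}" for t
  proof -
    have "(r has_real_derivative \<rho> (t *\<^sub>R \<omega>)) (at t within {0..T})"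
      unfolding r_def
      by (rule integral_has_real_derivative[OF continuous_on_ray[OF cont \<omega> T(2)]]) (use t in auto)
    then have "(r has_real_derivative \<rho> (t *\<^sub>R \<omega>)) (at t within {1/2..T})"
      by (rule has_field_derivative_subset) auto
    moreover have "0 < 1 + r t"
      using r0[of t] t T by auto
    ultimately show ?thesis
      unfolding g_def by (auto intro!: derivative_eq_intros simp: field_simps powr_diff)
  qed
  have "(g has_integral (1 + r T) powr p - (1 + r (1/2)) powr p) {1/2..T}"
    using T deriv by (intro fundamental_theorem_of_calculus)
      (auto simp: has_real_derivative_iff_has_vector_derivative)
  moreover have g0: "0 \<le> g t" if "t \<in> {1/2..T}" for t
  proof -
    have "0 < \<rho> (t *\<^sub>R \<omega>)"
      using that pos \<omega> T by auto
    then show ?thesis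
      using p by (auto simp: g_def intro!: mult_nonneg_nonneg)
  qed
  ultimately have int: "(\<integral>\<^sup>+t. indicator {1/2..T} t * g t \<partial>lborel) = ennreal ((1 + r T) powr p - (1 + r (1/2)) powr p)"
    by (intro nn_integral_has_integral_lebesgue) auto
  have le: "g t \<le> \<rho> (t *\<^sub>R \<omega>) ^ n * (1 + R (t *\<^sub>R \<omega>)) powr - (real n * (1 + p)) + (1 + R (t *\<^sub>R \<omega>)) powr (4 * p)"
    if t: "1/2 < t" "t < 1" for t
  proof -
    define w where "w = 1 + r t"
    have w: "1 \<le> w" using r0[of t] t by (simp add: w_def)
    have \<rho>t: "0 < \<rho> (t *\<^sub>R \<omega>)" using pos \<omega> t by auto
    have "g t = p * (w powr (p - 1) * \<rho> (t *\<^sub>R \<omega>))"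
      by (simp add: g_def w_def)
    also have "\<dots> \<le> 1 * (w powr (p - 1) * \<rho> (t *\<^sub>R \<omega>))"
      using p \<rho>t by (intro mult_right_mono) auto
    \<comment> \<open>The exponent p - 1 is split as -(1 + p) + 2p. The n-th power of the first
      factor then carries the weight exponent n(1 + p) > n that
      \<open>volume_growth_weighted\<close> requires, and the square of the second is (1 +
      R)^(4p).\<close>
    also have "\<dots> = (\<rho> (t *\<^sub>R \<omega>) * w powr - (1 + p)) * w powr (2 * p)"
      by (simp add: powr_add[symmetric] mult.assoc)
    also have "\<dots> \<le> (\<rho> (t *\<^sub>R \<omega>) * w powr - (1 + p)) ^ n + (w powr (2 * p)) ^ 2"
      using \<rho>t w p n by (intro mult_le_power_add_square) (auto intro: ge_one_powr_ge_zero)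
    also have "\<dots> = \<rho> (t *\<^sub>R \<omega>) ^ n * w powr - (real n * (1 + p)) + w powr (4 * p)"
      using w by (simp add: power_mult_distrib powr_realpow[symmetric] powr_powr algebra_simps)
    finally show ?thesis
      using Rr[of t] t by (simp add: w_def)
  qed
  \<comment> \<open>A negative difference is sent to 0 by \<open>ennreal\<close>, so the inequality
    holds in either case.\<close>
  have "ennreal ((1 + r T) powr p) \<le> ennreal ((1 + r (1/2)) powr p) + ennreal ((1 + r T) powr p - (1 + r (1/2)) powr p)"
    by (cases "(1 + r (1/2)) powr p \<le> (1 + r T) powr p")
       (auto simp: ennreal_plus[symmetric] ennreal_neg simp del: ennreal_plus intro!: ennreal_leI)
  also have "ennreal ((1 + r T) powr p - (1 + r (1/2)) powr p)
    \<le> (\<integral>\<^sup>+t\<in>{1/2<..<1}. ennreal (\<rho> (t *\<^sub>R \<omega>) ^ n * (1 + R (t *\<^sub>R \<omega>)) powr - (real n * (1 + p)))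
        + ennreal ((1 + R (t *\<^sub>R \<omega>)) powr (4 * p)) \<partial>lborel)"
    unfolding int[symmetric]
  proof (rule nn_integral_mono_AE)
    have "AE t::real in lborel. t \<noteq> 1/2"
      by (rule AE_lborel_singleton)
    then show "AE t in lborel. ennreal (indicator {1/2..T} t * g t)
      \<le> (ennreal (\<rho> (t *\<^sub>R \<omega>) ^ n * (1 + R (t *\<^sub>R \<omega>)) powr - (real n * (1 + p)))
        + ennreal ((1 + R (t *\<^sub>R \<omega>)) powr (4 * p))) * indicator {1/2<..<1} t"
    proof eventually_elim
      case (elim t)
      show ?case
      proof (cases "t \<in> {1/2..T}")
        case True
        then have t: "1/2 < t" "t < 1" using elim T by auto
        have "0 \<le> \<rho> (t *\<^sub>R \<omega>)" using pos \<omega> t by (auto intro: less_imp_le)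
        with le[OF t] True t show ?thesis
          by (simp add: ennreal_plus[symmetric] ennreal_leI del: ennreal_plus)
      qed simp
    qed
  qed
  finally show ?thesis
    using Rr[of T] Rr[of "1/2"] T by (simp add: add_left_mono)
qed

text \<open>Monotone convergence along radii tending to 1 carries the uniform bound to the whole
  ray. For finite K, a p-th root bounds the integral itself; its finiteness selects the real branch
  of \<open>ennreal_rpow\<close>, after which the p-th power is restored.\<close>

lemma ennreal_rpow_radial_integral_le:
  fixes \<omega> :: "'a::euclidean_space"
  assumes cont: "continuous_on (ball 0 1) \<rho>" and pos: "\<forall>x\<in>ball 0 1. 0 < \<rho> x"
    and \<omega>: "norm \<omega> = 1" and p: "0 < p"
    and K: "\<And>T. 1/2 < T \<Longrightarrow> T < 1 \<Longrightarrow> ennreal ((1 + radial_length \<rho> (T *\<^sub>R \<omega>)) powr p) \<le> K"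
  shows "ennreal_rpow (\<integral>\<^sup>+t\<in>{0<..<1}. ennreal (\<rho> (t *\<^sub>R \<omega>)) \<partial>lborel) p \<le> K"
proof (cases K)
  case (real k)
  \<comment> \<open>The shift by 3 makes the first radius 2/3, so that all radii lie in the range
    (1/2, 1) of the hypothesis.\<close>
  define T where "T i = 1 - 1 / real (i + 3)" for i :: nat
  have T: "1/2 < T i" "T i < 1" for i
    by (auto simp: T_def field_simps)
  have incT: "T i \<le> T j" if "i \<le> j" for i j
    using that by (auto simp: T_def field_simps)
  let ?f = "\<lambda>i t. ennreal (\<rho> (t *\<^sub>R \<omega>)) * indicator {0..T i} t"
  have f_meas: "?f i \<in> borel_measurable lborel" for i
  proof -
    note [measurable] = borel_measurable_ball_density[OF cont]
    have eq: "?f i = (\<lambda>t. ennreal (indicator (ball 0 1) (t *\<^sub>R \<omega>) *\<^sub>R \<rho> (t *\<^sub>R \<omega>)) * indicator {0..T i} t)"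
      using T[of i] \<omega> by (auto simp: fun_eq_iff split: split_indicator)
    show ?thesis unfolding eq by measurable
  qed
  have "(\<integral>\<^sup>+t\<in>{0<..<1}. ennreal (\<rho> (t *\<^sub>R \<omega>)) \<partial>lborel) \<le> (\<integral>\<^sup>+t. (SUP i. ?f i t) \<partial>lborel)"
  proof (rule nn_integral_mono)
    fix t :: real
    show "ennreal (\<rho> (t *\<^sub>R \<omega>)) * indicator {0<..<1} t \<le> (SUP i. ?f i t)"
    proof (cases "t \<in> {0<..<1}")
      case True
      then obtain i where "1 / (1 - t) < real i"
        using reals_Archimedean2 by blast
      then have "t \<le> T i"
        using True by (auto simp: T_def field_simps)
      then show ?thesis
        using True by (intro SUP_upper2[of i]) auto
    qed simp
  qed
  also have "\<dots> = (SUP i. integral\<^sup>N lborel (?f i))"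
    using f_meas incT
    by (intro nn_integral_monotone_convergence_SUP)
       (auto simp: incseq_def le_fun_def split: split_indicator intro: order_trans)
  also have "\<dots> \<le> ennreal (k powr (1 / p))"
  proof (rule SUP_least)
    fix i
    let ?R = "radial_length \<rho> (T i *\<^sub>R \<omega>)"
    have R: "0 \<le> ?R" by (rule radial_length_nonneg[OF pos])
    have "(1 + ?R) powr p \<le> k"
      using K[OF T, of i] real by (simp add: ennreal_le_iff)
    then have "((1 + ?R) powr p) powr (1 / p) \<le> k powr (1 / p)"
      using p by (intro powr_mono2) auto
    then have "?R \<le> k powr (1 / p)"
      using p R by (simp add: powr_powr)
    then have "ennreal ?R \<le> ennreal (k powr (1 / p))"
      by (rule ennreal_leI)
    then show "integral\<^sup>N lborel (?f i) \<le> ennreal (k powr (1 / p))"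
      using radial_length_ray(2)[OF cont pos \<omega>, of "T i"] T[of i] by simp
  qed
  finally have J: "(\<integral>\<^sup>+t\<in>{0<..<1}. ennreal (\<rho> (t *\<^sub>R \<omega>)) \<partial>lborel) \<le> ennreal (k powr (1 / p))" (is "?J \<le> _") .
  then have fin: "?J \<noteq> \<infinity>"
    by (auto simp: top_unique)
  have "enn2real ?J \<le> k powr (1 / p)"
    using J by (simp add: enn2real_leI)
  then have "enn2real ?J powr p \<le> (k powr (1 / p)) powr p"
    using p by (intro powr_mono2) auto
  also have "\<dots> = k"
    using p real by (simp add: powr_powr)
  finally show ?thesis
    using fin real by (simp add: ennreal_rpow_def ennreal_leI)
qed simp

section \<open>Choice of the exponent and integration over the sphere\<close>

theorem corollary1p4:
  fixes A B :: real
  assumes "CARD('n::finite) \<ge> 2" and "A \<ge> 1" and "B > 0"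
  shows "\<exists>p0::real. p0 > 0 \<and>
    (\<forall>(p::real) (\<rho>::real^'n \<Rightarrow> real).
       0 < p \<and> p < p0 \<and> conformal_density \<rho> \<and> harnack_ineq A \<rho> \<and> volume_growth B \<rho> \<longrightarrow>
       (\<integral>\<^sup>+\<omega>. ennreal_rpow (\<integral>\<^sup>+t\<in>{0<..<1}. ennreal (\<rho> (t *\<^sub>R \<omega>)) \<partial>lborel) p
          \<partial>sphere_measure) < \<infinity>)"
proof -
  obtain m :: nat where m: "A \<le> (4/3) ^ m"
    using real_arch_pow[of "4/3" A] by (auto intro: less_imp_le)
  show ?thesis
  \<comment> \<open>For p below this value both 4pm < 1, as the integrability of (1 - t)^(-4pm)
    demands, and p < 1; the summand 1 covers m = 0. The integer m was chosen from A alone.\<close>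
  proof (intro exI[of _ "1 / (4 * (real m + 1))"] conjI allI impI)
    show "0 < 1 / (4 * (real m + 1))"
      by simp
  next
    fix p :: real and \<rho> :: "real^'n \<Rightarrow> real"
    assume *: "0 < p \<and> p < 1 / (4 * (real m + 1)) \<and> conformal_density \<rho> \<and> harnack_ineq A \<rho> \<and> volume_growth B \<rho>"
    then have cont: "continuous_on (ball 0 1) \<rho>" and pos: "\<forall>x\<in>ball 0 1. 0 < \<rho> x"
      and harnack: "harnack_ineq A \<rho>" and vol: "volume_growth B \<rho>" and p0: "0 < p"
      by (auto simp: conformal_density_def)
    have pm: "4 * p * real m + 4 * p < 1"
      using * by (auto simp: field_simps)
    moreover have "0 \<le> 4 * p * real m"
      using p0 by simp
    ultimately have p1: "p < 1" and pm1: "4 * p * real m < 1"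
      using p0 by linarith+
    let ?n = "CARD('n)" and ?R = "radial_length \<rho>" and ?S = "sphere_measure :: (real^'n) measure"
    note [measurable] = borel_measurable_ball_density[OF cont] borel_measurable_radial_length[OF cont]
    \<comment> \<open>The first Young term, with \<rho> cut off to the ball so that F is Borel on
      the whole space.\<close>
    define F where "F y = ennreal ((indicator (ball 0 1) y *\<^sub>R \<rho> y) ^ ?n * (1 + ?R y) powr - (real ?n * (1 + p)))"
      for y :: "real^'n"
    have F_meas[measurable]: "F \<in> borel_measurable borel"
      unfolding F_def by measurable
    define H where "H \<omega> = (\<integral>\<^sup>+t\<in>{1/2<..<1}. F (t *\<^sub>R \<omega>) \<partial>lborel)" for \<omega> :: "real^'n"
    have H_meas: "H \<in> borel_measurable borel"
      unfolding H_def by measurable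
    \<comment> \<open>C turns the growth bound into 1 + R \<le> C (1 - t)^(-m). From it come D,
      bounding the integral of the second Young term, and c, bounding the initial value at t = 1/2,
      where (1 - t)^(-m) = 2^m. None of the three depends on \<omega>.\<close>
    define C where "C = 1 + (4/3) ^ m * \<rho> 0"
    define D where "D = ennreal (C powr (4 * p)) * (\<integral>\<^sup>+t\<in>{0<..<1}. ennreal ((1 - t) powr - (4 * p * real m)) \<partial>lborel)"
    define c where "c = ennreal ((C * 2 ^ m) powr p)"
    have C: "0 < C"
      using pos by (auto simp: C_def intro!: add_pos_nonneg less_imp_le)
    have growth: "1 + ?R (t *\<^sub>R \<omega>) \<le> C / (1 - t) ^ m"
      if "norm \<omega> = 1" "0 < t" "t < 1" for t and \<omega> :: "real^'n"
    proof -
      have "?R (t *\<^sub>R \<omega>) \<le> (4/3) ^ m * \<rho> 0 / (1 - t) ^ m"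
        using cont pos harnack assms(2) m that by (rule radial_length_growth)
      moreover have "1 \<le> 1 / (1 - t) ^ m"
        using that by (simp add: power_le_one)
      ultimately show ?thesis
        by (simp add: C_def add_divide_distrib)
    qed
    have R0: "0 \<le> ?R y" for y
      by (rule radial_length_nonneg[OF pos])
    \<comment> \<open>Only \<open>H \<omega>\<close> varies with the direction, so after this bound
      the total mass of the sphere and the integral of H remain to be controlled.\<close>
    have pointwise: "ennreal_rpow (\<integral>\<^sup>+t\<in>{0<..<1}. ennreal (\<rho> (t *\<^sub>R \<omega>)) \<partial>lborel) p \<le> (c + D) + H \<omega>"
      if \<omega>: "norm \<omega> = 1" for \<omega> :: "real^'n"
    proof (rule ennreal_rpow_radial_integral_le[OF cont pos \<omega> p0])
      fix T :: real assume T: "1/2 < T" "T < 1"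
      have "(1 + ?R ((1/2) *\<^sub>R \<omega>)) powr p \<le> (C * 2 ^ m) powr p"
        using growth[of \<omega> "1/2"] \<omega> p0 R0[of "(1/2) *\<^sub>R \<omega>"]
        by (intro powr_mono2) (auto simp: power_one_over)
      then have 1: "ennreal ((1 + ?R ((1/2) *\<^sub>R \<omega>)) powr p) \<le> c"
        unfolding c_def by (rule ennreal_leI)
      let ?I = "\<integral>\<^sup>+t\<in>{1/2<..<1}. ennreal ((1 + ?R (t *\<^sub>R \<omega>)) powr (4 * p)) \<partial>lborel"
      have "(\<integral>\<^sup>+t\<in>{1/2<..<1}. ennreal (\<rho> (t *\<^sub>R \<omega>) ^ ?n * (1 + ?R (t *\<^sub>R \<omega>)) powr - (real ?n * (1 + p)))
          + ennreal ((1 + ?R (t *\<^sub>R \<omega>)) powr (4 * p)) \<partial>lborel)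
        = (\<integral>\<^sup>+t. F (t *\<^sub>R \<omega>) * indicator {1/2<..<1} t
            + ennreal ((1 + ?R (t *\<^sub>R \<omega>)) powr (4 * p)) * indicator {1/2<..<1} t \<partial>lborel)"
        using \<omega> by (intro nn_integral_cong) (auto simp: F_def split: split_indicator)
      also have "\<dots> = H \<omega> + ?I"
        unfolding H_def by (intro nn_integral_add) measurable
      finally have split: "(\<integral>\<^sup>+t\<in>{1/2<..<1}. ennreal (\<rho> (t *\<^sub>R \<omega>) ^ ?n * (1 + ?R (t *\<^sub>R \<omega>)) powr - (real ?n * (1 + p)))
          + ennreal ((1 + ?R (t *\<^sub>R \<omega>)) powr (4 * p)) \<partial>lborel) = H \<omega> + ?I" .
      have "?I \<le> (\<integral>\<^sup>+t. ennreal (C powr (4 * p)) * (ennreal ((1 - t) powr - (4 * p * real m)) * indicator {0<..<1} t) \<partial>lborel)"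
      proof (rule nn_integral_mono)
        fix t :: real
        show "ennreal ((1 + ?R (t *\<^sub>R \<omega>)) powr (4 * p)) * indicator {1/2<..<1} t
          \<le> ennreal (C powr (4 * p)) * (ennreal ((1 - t) powr - (4 * p * real m)) * indicator {0<..<1} t)"
        proof (cases "t \<in> {1/2<..<1}")
          case True
          then have t: "0 < t" "t < 1" by auto
          have "(1 + ?R (t *\<^sub>R \<omega>)) powr (4 * p) \<le> (C * (1 - t) powr - real m) powr (4 * p)"
            using growth[OF \<omega> t] p0 R0[of "t *\<^sub>R \<omega>"] t
            by (intro powr_mono2) (auto simp: powr_minus powr_realpow divide_inverse)
          also have "\<dots> = C powr (4 * p) * (1 - t) powr - (4 * p * real m)"
            using C by (simp add: powr_mult powr_powr mult_ac)
          finally show ?thesis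
            using True t by (simp add: ennreal_mult[symmetric] ennreal_leI)
        qed simp
      qed
      also have "\<dots> = D"
        unfolding D_def by (intro nn_integral_cmult) measurable
      finally have 2: "?I \<le> D" .
      have "ennreal ((1 + ?R (T *\<^sub>R \<omega>)) powr p) \<le> ennreal ((1 + ?R ((1/2) *\<^sub>R \<omega>)) powr p) + (H \<omega> + ?I)"
        using radial_length_powr_le[OF cont pos \<omega> T p0 p1 assms(1)] by (simp only: split)
      also have "\<dots> \<le> c + (H \<omega> + D)"
        by (intro add_mono 1 2 order_refl)
      finally show "ennreal ((1 + ?R (T *\<^sub>R \<omega>)) powr p) \<le> (c + D) + H \<omega>"
        by (simp only: ac_simps)
    qed
    have "(\<integral>\<^sup>+\<omega>. ennreal_rpow (\<integral>\<^sup>+t\<in>{0<..<1}. ennreal (\<rho> (t *\<^sub>R \<omega>)) \<partial>lborel) p \<partial>?S)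
        \<le> (\<integral>\<^sup>+\<omega>. (c + D) + H \<omega> \<partial>?S)"
      by (intro nn_integral_mono pointwise) simp
    also have "\<dots> = (\<integral>\<^sup>+\<omega>. c + D \<partial>?S) + (\<integral>\<^sup>+\<omega>. H \<omega> \<partial>?S)"
    proof (rule nn_integral_add)
      show "H \<in> borel_measurable ?S"
        using measurable_restrict_space1[OF H_meas] by (simp cong: measurable_cong_sets add: sets_sphere_measure)
    qed simp
    also have "\<dots> < \<infinity>"
    proof -
      have "D < \<infinity>"
        unfolding D_def using nn_integral_one_minus_powr_finite[OF pm1] by (simp add: ennreal_mult_less_top)
      then have "(\<integral>\<^sup>+\<omega>. c + D \<partial>?S) < \<infinity>"
        using emeasure_sphere_measure_finite[where 'n='n] by (simp add: ennreal_mult_less_top c_def)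
      moreover have "(\<integral>\<^sup>+\<omega>. H \<omega> \<partial>?S) < \<infinity>"
      proof -
        have "(\<integral>\<^sup>+y\<in>ball 0 1. F y \<partial>lborel)
            = (\<integral>\<^sup>+y\<in>ball 0 1. ennreal (\<rho> y ^ ?n * (1 + ?R y) powr - (real ?n * (1 + p))) \<partial>lborel)"
          by (intro nn_integral_cong) (simp add: F_def split: split_indicator)
        \<comment> \<open>The weight exponent n(1 + p) exceeds n because p > 0, as the dyadic
          summation requires.\<close>
        also have "\<dots> < \<infinity>"
          using p0 by (intro volume_growth_weighted[OF cont pos vol assms(3)]) simp
        finally show ?thesis
          unfolding H_def
          using nn_integral_inverse_power_finite[OF assms(1)]
          by (intro le_less_trans[OF nn_integral_sphere_measure_radial_le[OF F_meas]])
             (simp add: ennreal_mult_less_top of_nat_less_top)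
      qed
      ultimately show ?thesis by simp
    qed
    finally show "(\<integral>\<^sup>+\<omega>. ennreal_rpow (\<integral>\<^sup>+t\<in>{0<..<1}. ennreal (\<rho> (t *\<^sub>R \<omega>)) \<partial>lborel) p \<partial>?S) < \<infinity>" .
  qed
qed

end
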